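(* Let $\mathbb{F}$ be an ordered subfield of $\mathbb{R}$. Then $\mathbb{F}$ is complete if and only if for all $a,b\in\mathbb{F}$ with $a<b$, every continuous function $f:[a,b]_{\mathbb{F}}\to\mathbb{F}$ has a uniformly differentiable anti-derivative, i.e. there exists a uniformly differentiable function $G:[a,b]_{\mathbb{F}}\to\mathbb{F}$ with $G'(x)=f(x)$ for all $x\in[a,b]_{\mathbb{F}}$.
   Context: $\mathbb{F}$ denotes a subfield of $\mathbb{R}$ with the induced order (so $\mathbb{Q}\subset\mathbb{F}\subset\mathbb{R}$), and $\mathbb{F}^+$ is the set of its positive elements. "$\mathbb{F}$ is complete" means every nonempty subset of $\mathbb{F}$ bounded above has a supremum in $\mathbb{F}$; equivalently, $\mathbb{F}=\mathbb{R}$. For $a,b\in\mathbb{F}$, $a<b$, write $[a,b]_{\mathbb{F}}=[a,b]\cap\mathbb{F}$, where $[a,b]$ is the real interval. Continuity is in the usual $\epsilon$-$\delta$ sense with $\epsilon,\delta\in\mathbb{F}^+$. For $G:[a,b]_{\mathbb{F}}\to\mathbb{F}$ and $x\neq y$ in $[a,b]_{\mathbb{F}}$, put $D_y[G](x)=\frac{G(x)-G(y)}{x-y}$. $G$ is uniformly differentiable on $[a,b]_{\mathbb{F}}$ if there exists a function $g:[a,b]_{\mathbb{F}}\to\mathbb{F}$ such that for every $\epsilon\in\mathbb{F}^+$ there is a $\delta\in\mathbb{F}^+$ with $|D_y[G](x)-g(y)|<\epsilon$ for all $x,y\in[a,b]_{\mathbb{F}}$ with $0<|x-y|<\delta$.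 In this case $g$ is unique and is called the derivative of $G$, written $G'=g$. *)

theory Defs
  imports Complex_Main "HOL-Library.FuncSet"
begin

definition real_subfield :: "real set \<Rightarrow> bool" where
  "real_subfield F \<longleftrightarrow>
     0 \<in> F \<and> 1 \<in> F \<and>
     (\<forall>x\<in>F. \<forall>y\<in>F. x + y \<in> F) \<and> (\<forall>x\<in>F. - x \<in> F) \<and>
     (\<forall>x\<in>F. \<forall>y\<in>F. x * y \<in> F) \<and> (\<forall>x\<in>F. x \<noteq> 0 \<longrightarrow> inverse x \<in> F)"

definition pos_part :: "real set \<Rightarrow> real set" where
  "pos_part F = {x \<in> F. 0 < x}"

text \<open>Upper bounds and suprema are taken inside \<open>F\<close>, not in the reals.\<close>

definition is_sup_in :: "real set \<Rightarrow> real set \<Rightarrow> real \<Rightarrow> bool" where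
  "is_sup_in F S s \<longleftrightarrow>
     s \<in> F \<and> (\<forall>x\<in>S. x \<le> s) \<and> (\<forall>u\<in>F. (\<forall>x\<in>S. x \<le> u) \<longrightarrow> s \<le> u)"

definition order_complete :: "real set \<Rightarrow> bool" where
  "order_complete F \<longleftrightarrow>
     (\<forall>S. S \<subseteq> F \<and> S \<noteq> {} \<and> (\<exists>u\<in>F. \<forall>x\<in>S. x \<le> u) \<longrightarrow> (\<exists>s. is_sup_in F S s))"

definition ivl :: "real set \<Rightarrow> real \<Rightarrow> real \<Rightarrow> real set" where
  "ivl F a b = {a..b} \<inter> F"

text \<open>
  A function on \<open>ivl F a b\<close> is represented by a total function on the reals, of which only
  the values on \<open>ivl F a b\<close> are relevant.
\<close>

definition continuous_ivl :: "real set \<Rightarrow> real \<Rightarrow> real \<Rightarrow> (real \<Rightarrow> real) \<Rightarrow> bool" where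
  "continuous_ivl F a b f \<longleftrightarrow>
     (\<forall>y\<in>ivl F a b. \<forall>\<epsilon>\<in>pos_part F. \<exists>\<delta>\<in>pos_part F.
        \<forall>x\<in>ivl F a b. \<bar>x - y\<bar> < \<delta> \<longrightarrow> \<bar>f x - f y\<bar> < \<epsilon>)"

definition diff_quot :: "(real \<Rightarrow> real) \<Rightarrow> real \<Rightarrow> real \<Rightarrow> real" where
  "diff_quot G y x = (G x - G y) / (x - y)"

definition has_unif_deriv ::
    "real set \<Rightarrow> real \<Rightarrow> real \<Rightarrow> (real \<Rightarrow> real) \<Rightarrow> (real \<Rightarrow> real) \<Rightarrow> bool" where
  "has_unif_deriv F a b G g \<longleftrightarrow>
     g \<in> ivl F a b \<rightarrow> F \<and>
     (\<forall>\<epsilon>\<in>pos_part F. \<exists>\<delta>\<in>pos_part F. \<forall>x\<in>ivl F a b. \<forall>y\<in>ivl F a b.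
        0 < \<bar>x - y\<bar> \<and> \<bar>x - y\<bar> < \<delta> \<longrightarrow> \<bar>diff_quot G y x - g y\<bar> < \<epsilon>)"

definition unif_differentiable :: "real set \<Rightarrow> real \<Rightarrow> real \<Rightarrow> (real \<Rightarrow> real) \<Rightarrow> bool" where
  "unif_differentiable F a b G \<longleftrightarrow> (\<exists>g. has_unif_deriv F a b G g)"

text \<open>
  The derivative is unique only on \<open>ivl F a b\<close>; extensionality fixes its irrelevant values
  outside, so that the description below is proper.
\<close>

definition unif_deriv :: "real set \<Rightarrow> real \<Rightarrow> real \<Rightarrow> (real \<Rightarrow> real) \<Rightarrow> real \<Rightarrow> real" where
  "unif_deriv F a b G = (THE g. g \<in> extensional (ivl F a b) \<and> has_unif_deriv F a b G g)"

lemma has_unif_deriv_unique: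
  assumes F: "real_subfield F" and ab: "a \<in> F" "b \<in> F" "a < b"
    and g: "has_unif_deriv F a b G g" and h: "has_unif_deriv F a b G h"
    and y: "y \<in> ivl F a b"
  shows "g y = h y"
proof (rule ccontr)
  assume ne: "g y \<noteq> h y"
  have add: "u + v \<in> F" and mult: "u * v \<in> F" if "u \<in> F" "v \<in> F" for u v
    using F that by (simp_all add: real_subfield_def)
  have neg: "- u \<in> F" if "u \<in> F" for u
    using F that by (simp add: real_subfield_def)
  have diff: "u - v \<in> F" if "u \<in> F" "v \<in> F" for u v
    using add[OF that(1) neg[OF that(2)]] by simp
  have "1 \<in> F" using F by (simp add: real_subfield_def)
  then have "2 \<in> F" using add[of 1 1] by simp
  moreover have "x \<noteq> 0 \<Longrightarrow> inverse x \<in> F" if "x \<in> F" for x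
    using F that by (simp add: real_subfield_def)
  ultimately have "inverse 2 \<in> F" by (metis zero_neq_numeral)
  then have half: "u / 2 \<in> F" if "u \<in> F" for u
    using mult[OF that, of "inverse 2"] by (simp only: divide_inverse)
  have yF: "y \<in> F" "a \<le> y" "y \<le> b" using y by (auto simp: ivl_def)
  have gF: "g y \<in> F" and hF: "h y \<in> F"
    using g h y by (auto simp: has_unif_deriv_def)
  define e where "e = \<bar>g y - h y\<bar> / 2"
  have "\<bar>g y - h y\<bar> \<in> F" using diff[OF gF hF] diff[OF hF gF] by (auto simp: abs_if)
  then have e: "e \<in> pos_part F" using half[of "\<bar>g y - h y\<bar>"] ne by (simp add: e_def pos_part_def)
  obtain d1 where d1: "d1 \<in> pos_part F" "\<And>x. x \<in> ivl F a b \<Longrightarrow> 0 < \<bar>x - y\<bar> \<Longrightarrow> \<bar>x - y\<bar> < d1 \<Longrightarrow>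
      \<bar>diff_quot G y x - g y\<bar> < e"
    using g e y unfolding has_unif_deriv_def by blast
  obtain d2 where d2: "d2 \<in> pos_part F" "\<And>x. x \<in> ivl F a b \<Longrightarrow> 0 < \<bar>x - y\<bar> \<Longrightarrow> \<bar>x - y\<bar> < d2 \<Longrightarrow>
      \<bar>diff_quot G y x - h y\<bar> < e"
    using h e y unfolding has_unif_deriv_def by blast
  define d where "d = min d1 d2"
  have d: "d \<in> F" "0 < d" "d \<le> d1" "d \<le> d2"
    using d1(1) d2(1) by (auto simp: d_def pos_part_def min_def)
  obtain x where x: "x \<in> ivl F a b" "0 < \<bar>x - y\<bar>" "\<bar>x - y\<bar> < d"
  proof (cases "y < b")
    case True
    define t where "t = min (d / 2) (b - y)"
    have "t \<in> F" "0 < t" "t < d" "t \<le> b - y"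
      using half[OF d(1)] diff[OF ab(2) yF(1)] d(2) True by (auto simp: t_def min_def)
    then show ?thesis using that[of "y + t"] add[OF yF(1)] yF by (auto simp: ivl_def)
  next
    case False
    define t where "t = min (d / 2) (b - a)"
    have "t \<in> F" "0 < t" "t < d" "t \<le> b - a"
      using half[OF d(1)] diff[OF ab(2) ab(1)] d(2) ab(3) by (auto simp: t_def min_def)
    then show ?thesis using that[of "y - t"] diff[OF yF(1)] yF False by (auto simp: ivl_def)
  qed
  have "\<bar>diff_quot G y x - g y\<bar> < e" using d1(2) x d by simp
  moreover have "\<bar>diff_quot G y x - h y\<bar> < e" using d2(2) x d by simp
  ultimately show False unfolding e_def by argo
qed

lemma unif_deriv_eq:
  assumes "real_subfield F" "a \<in> F" "b \<in> F" "a < b"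
    and g: "has_unif_deriv F a b G g" and y: "y \<in> ivl F a b"
  shows "unif_deriv F a b G y = g y"
proof -
  let ?r = "restrict g (ivl F a b)"
  have r: "has_unif_deriv F a b G ?r"
    using g by (simp add: has_unif_deriv_def Pi_iff)
  have "unif_deriv F a b G = ?r"
    unfolding unif_deriv_def
  proof (rule the_equality)
    show "?r \<in> extensional (ivl F a b) \<and> has_unif_deriv F a b G ?r" using r by simp
  next
    fix k assume k: "k \<in> extensional (ivl F a b) \<and> has_unif_deriv F a b G k"
    show "k = ?r"
      by (rule extensionalityI[of _ "ivl F a b"])
        (use k has_unif_deriv_unique[OF assms(1-4) _ r] in auto)
  qed
  then show ?thesis using y by simp
qed

end

theory Submission
  imports Defs "HOL-Analysis.Analysis"
begin

text \<open>
  A uniform derivative is uniformly continuous, since the difference quotient is symmetric in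
  its two arguments.  If the field misses a supremum \<open>c\<close>, the indicator of \<open>x > c\<close> is continuous
  on the field but not uniformly so near \<open>c\<close>, hence has no uniformly differentiable
  anti-derivative.  Conversely a complete field is all of the reals; there the integral of \<open>f\<close>
  is an anti-derivative, and uniform differentiability follows from the mean value theorem
  together with uniform continuity of \<open>f\<close>.
\<close>

lemma Rats_subset_real_subfield:
  assumes "real_subfield F"
  shows "\<rat> \<subseteq> F"
proof
  have nat: "real n \<in> F" for n
    using assms by (induction n) (auto simp: real_subfield_def)
  have int: "real_of_int i \<in> F" for i
    using nat assms by (cases i rule: int_cases2) (auto simp: real_subfield_def)
  fix q :: real
  assume "q \<in> \<rat>"
  then obtain i j where "j \<noteq> 0" "q = real_of_int i * inverse (real_of_int j)"
    by (metis Rats_cases' divide_inverse less_irrefl)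
  with int assms show "q \<in> F"
    by (simp add: real_subfield_def)
qed

text \<open>Every subfield of the reals inherits density from the rationals it contains. This is
  what supplies tolerances and test points inside \<open>F\<close> where only real bounds are at
  hand.\<close>

lemma real_subfield_dense:
  assumes "real_subfield F" "x < y"
  obtains q where "q \<in> F" "x < q" "q < y"
  using Rats_dense_in_real[OF assms(2)] Rats_subset_real_subfield[OF assms(1)] by blast

text \<open>Any real \<open>r\<close> is forced to equal the supremum, taken in \<open>F\<close>, of
  the cut of elements of \<open>F\<close> below \<open>r\<close>: by density, no other position of
  that supremum is possible.\<close>

lemma order_complete_real_subfield:
  assumes F: "real_subfield F" and complete: "order_complete F"
  shows "F = UNIV"
proof -
  have "r \<in> F" for r
  proof -
    let ?S = "{x \<in> F. x < r}"
    obtain l where "l \<in> F" "l < r"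
      using real_subfield_dense[OF F, of "r - 1" r] by auto
    moreover obtain u where "u \<in> F" "r < u"
      using real_subfield_dense[OF F, of r "r + 1"] by auto
    ultimately have "?S \<subseteq> F \<and> ?S \<noteq> {} \<and> (\<exists>u\<in>F. \<forall>x\<in>?S. x \<le> u)"
      by force
    then obtain s where s: "is_sup_in F ?S s"
      using complete unfolding order_complete_def by blast
    have "\<not> s < r"
    proof
      assume "s < r"
      then obtain q where "q \<in> F" "s < q" "q < r"
        by (rule real_subfield_dense[OF F])
      with s show False by (auto simp: is_sup_in_def)
    qed
    \<comment> \<open>Here an element of \<open>F\<close> strictly between \<open>r\<close> and
      \<open>s\<close> would be an upper bound of the cut smaller than its supremum.\<close>
    moreover have "\<not> r < s"
    proof
      assume "r < s"
      then obtain q where q: "q \<in> F" "r < q" "q < s"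
        by (rule real_subfield_dense[OF F])
      then have "s \<le> q"
        using s by (simp add: is_sup_in_def)
      with q show False by simp
    qed
    ultimately show ?thesis
      using s by (simp add: is_sup_in_def)
  qed
  then show ?thesis by blast
qed

text \<open>The gap \<open>c\<close> is the real supremum of a set that has no supremum in
  \<open>F\<close>. An element and an upper bound of that set serve as \<open>a\<close> and
  \<open>b\<close>; both lie in \<open>F\<close> and \<open>c\<close> does not, so the inequalities
  are strict.\<close>

lemma not_order_complete_gap:
  assumes "\<not> order_complete F"
  obtains a b c where "a \<in> F" "b \<in> F" "c \<notin> F" "a < c" "c < b"
proof -
  obtain S u where S: "S \<subseteq> F" "S \<noteq> {}" "u \<in> F" "\<forall>x\<in>S. x \<le> u" and no: "\<nexists>s. is_sup_in F S s"
    using assms unfolding order_complete_def by blast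
  then obtain a where a: "a \<in> S" by blast
  have bdd: "bdd_above S"
    using S by (auto simp: bdd_above_def)
  have "is_sup_in F S (Sup S)" if "Sup S \<in> F"
    using that S bdd by (auto simp: is_sup_in_def intro: cSup_upper cSup_least)
  with no have c: "Sup S \<notin> F" by blast
  have "a \<le> Sup S" "Sup S \<le> u"
    using S a bdd by (auto intro: cSup_upper cSup_least)
  moreover have "a \<in> F" using S a by blast
  ultimately show ?thesis
    using that[of a u "Sup S"] c S by (metis order_le_less)
qed

lemma has_unif_deriv_cong:
  assumes "has_unif_deriv F a b G g" "\<And>x. x \<in> ivl F a b \<Longrightarrow> f x = g x"
  shows "has_unif_deriv F a b G f"
  using assms by (simp add: has_unif_deriv_def Pi_iff)

lemma diff_quot_commute: "diff_quot G x y = diff_quot G y x"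
  unfolding diff_quot_def by (metis minus_diff_eq minus_divide_divide)

text \<open>One difference quotient is within \<epsilon> of both \<open>g x\<close> and
  \<open>g y\<close>, and the two errors add up to the bound \<open>2 * \<epsilon>\<close>.\<close>

lemma has_unif_deriv_uniformly_continuous:
  assumes "has_unif_deriv F a b G g" "\<epsilon> \<in> pos_part F"
  obtains \<delta> where "\<delta> \<in> pos_part F"
    "\<And>x y. x \<in> ivl F a b \<Longrightarrow> y \<in> ivl F a b \<Longrightarrow> \<bar>x - y\<bar> < \<delta> \<Longrightarrow> \<bar>g x - g y\<bar> < 2 * \<epsilon>"
proof -
  obtain \<delta> where \<delta>: "\<delta> \<in> pos_part F"
    "\<And>x y. x \<in> ivl F a b \<Longrightarrow> y \<in> ivl F a b \<Longrightarrow> 0 < \<bar>x - y\<bar> \<Longrightarrow> \<bar>x - y\<bar> < \<delta> \<Longrightarrow>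
       \<bar>diff_quot G y x - g y\<bar> < \<epsilon>"
    using assms unfolding has_unif_deriv_def by meson
  have "\<bar>g x - g y\<bar> < 2 * \<epsilon>" if "x \<in> ivl F a b" "y \<in> ivl F a b" "\<bar>x - y\<bar> < \<delta>" for x y
  proof (cases "x = y")
    case True
    with assms show ?thesis by (simp add: pos_part_def)
  next
    case False
    then have "\<bar>diff_quot G y x - g y\<bar> < \<epsilon>" "\<bar>diff_quot G y x - g x\<bar> < \<epsilon>"
      using \<delta>(2)[of x y] \<delta>(2)[of y x] that
      by (simp_all add: abs_minus_commute diff_quot_commute)
    then show ?thesis by argo
  qed
  with \<delta>(1) that show ?thesis by blast
qed

lemma continuous_ivl_step:
  assumes F: "real_subfield F" and "c \<notin> F"
  shows "continuous_ivl F a b (\<lambda>x. if x < c then 0 else 1)"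
  unfolding continuous_ivl_def
proof (intro ballI)
  fix y \<epsilon>
  assume y: "y \<in> ivl F a b" and \<epsilon>: "\<epsilon> \<in> pos_part F"
  then have "0 < \<bar>y - c\<bar>"
    using assms by (auto simp: ivl_def)
  \<comment> \<open>The distance from \<open>y\<close> to the gap need not lie in \<open>F\<close>,
    so a smaller \<delta> in \<open>F\<close> is chosen; moving by less than it cannot cross
    \<open>c\<close>.\<close>
  then obtain \<delta> where \<delta>: "\<delta> \<in> F" "0 < \<delta>" "\<delta> < \<bar>y - c\<bar>"
    by (rule real_subfield_dense[OF F])
  have "\<bar>(if x < c then 0 else 1) - (if y < c then 0 else 1)\<bar> < \<epsilon>"
    if "\<bar>x - y\<bar> < \<delta>" for x
  proof -
    have "x < c \<longleftrightarrow> y < c"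
      using \<delta> that by linarith
    with \<epsilon> show ?thesis
      by (cases "y < c") (simp_all add: pos_part_def)
  qed
  moreover have "\<delta> \<in> pos_part F"
    using \<delta> by (simp add: pos_part_def)
  ultimately show "\<exists>\<delta>\<in>pos_part F. \<forall>x\<in>ivl F a b. \<bar>x - y\<bar> < \<delta> \<longrightarrow>
      \<bar>(if x < c then 0 else 1) - (if y < c then 0 else 1)\<bar> < \<epsilon>"
    by blast
qed

lemma no_unif_deriv_step:
  assumes F: "real_subfield F" and c: "a < c" "c < b"
  shows "\<not> has_unif_deriv F a b G (\<lambda>x. if x < c then 0 else 1)"
proof
  assume deriv: "has_unif_deriv F a b G (\<lambda>x. if x < c then 0 else 1)"
  \<comment> \<open>With \<epsilon> equal to 1/2 the bound \<open>2 * \<epsilon>\<close> is exactly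
    the height of the jump, which the strict inequality forbids.\<close>
  have "1 / 2 \<in> pos_part F"
    using Rats_subset_real_subfield[OF F] by (auto simp: pos_part_def)
  then obtain \<delta> where "\<delta> \<in> pos_part F" and
    uc: "\<And>x y. x \<in> ivl F a b \<Longrightarrow> y \<in> ivl F a b \<Longrightarrow> \<bar>x - y\<bar> < \<delta> \<Longrightarrow>
      \<bar>(if x < c then 0 else 1) - (if y < c then 0 else 1)\<bar> < 2 * (1 / 2 :: real)"
    using has_unif_deriv_uniformly_continuous[OF deriv] by blast
  have "0 < \<delta>" using \<open>\<delta> \<in> pos_part F\<close> by (simp add: pos_part_def)
  \<comment> \<open>The points straddle \<open>c\<close>, each closer to it than
    \<open>\<delta> / 2\<close>; the \<open>max\<close> and \<open>min\<close> keep them inside the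
    interval.\<close>
  obtain x where x: "x \<in> F" "max a (c - \<delta> / 2) < x" "x < c"
    using real_subfield_dense[OF F, of "max a (c - \<delta> / 2)" c] c \<open>0 < \<delta>\<close> by auto
  obtain y where y: "y \<in> F" "c < y" "y < min b (c + \<delta> / 2)"
    using real_subfield_dense[OF F, of c "min b (c + \<delta> / 2)"] c \<open>0 < \<delta>\<close> by auto
  have "x \<in> ivl F a b" "y \<in> ivl F a b" "\<bar>x - y\<bar> < \<delta>"
    using x y c by (auto simp: ivl_def)
  from uc[OF this] show False
    using x y by simp
qed

lemma continuous_ivl_UNIV: "continuous_ivl UNIV a b f \<longleftrightarrow> continuous_on {a..b} f"
  by (simp add: continuous_ivl_def continuous_on_iff ivl_def pos_part_def dist_real_def Bex_def)

text \<open>By the mean value theorem each difference quotient is a value \<open>f z\<close> at an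
  intermediate point, and uniform continuity on the compact interval bounds its distance from
  \<open>f y\<close> independently of \<open>y\<close>.\<close>

lemma has_unif_deriv_UNIV:
  assumes cont: "continuous_on {a..b} f"
    and G: "\<And>x. x \<in> {a..b} \<Longrightarrow> (G has_real_derivative f x) (at x within {a..b})"
  shows "has_unif_deriv UNIV a b G f"
proof -
  have "\<exists>\<delta>>0. \<forall>x\<in>{a..b}. \<forall>y\<in>{a..b}. 0 < \<bar>x - y\<bar> \<and> \<bar>x - y\<bar> < \<delta> \<longrightarrow> \<bar>diff_quot G y x - f y\<bar> < \<epsilon>"
    if "0 < \<epsilon>" for \<epsilon>
  proof -
    obtain \<delta> where \<delta>: "0 < \<delta>"
      "\<And>x y. x \<in> {a..b} \<Longrightarrow> y \<in> {a..b} \<Longrightarrow> \<bar>x - y\<bar> < \<delta> \<Longrightarrow> \<bar>f x - f y\<bar> < \<epsilon>"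
      using compact_uniformly_continuous[OF cont compact_Icc] \<open>0 < \<epsilon>\<close>
      unfolding uniformly_continuous_on_def dist_real_def by metis
    have mvt: "\<exists>z. x < z \<and> z < y \<and> diff_quot G x y = f z"
      if "x \<in> {a..b}" "y \<in> {a..b}" "x < y" for x y
    proof -
      have "(G has_derivative (*) (f z)) (at z within {x..y})" if "x \<le> z" "z \<le> y" for z
        using G[of z] that \<open>x \<in> {a..b}\<close> \<open>y \<in> {a..b}\<close>
        by (auto simp: has_field_derivative_def intro: has_derivative_subset)
      then obtain z where "z \<in> {x<..<y}" "G y - G x = f z * (y - x)"
        using mvt_simple[OF \<open>x < y\<close>, of G "\<lambda>z. (*) (f z)"] by blast
      then show ?thesis
        by (auto simp: diff_quot_def)
    qed
    have "\<bar>diff_quot G y x - f y\<bar> < \<epsilon>"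
      if xy: "x \<in> {a..b}" "y \<in> {a..b}" "0 < \<bar>x - y\<bar>" "\<bar>x - y\<bar> < \<delta>" for x y
    proof -
      \<comment> \<open>Symmetry of the difference quotient reduces the case \<open>y < x\<close> to
        the ordered one. As \<open>z\<close> lies between the points, it is closer to
        \<open>y\<close> than \<open>x\<close> is.\<close>
      obtain z where "min x y < z" "z < max x y" "diff_quot G y x = f z"
        using mvt[of x y] mvt[of y x] xy
        by (cases x y rule: linorder_cases) (auto simp: diff_quot_commute)
      with \<delta>(2)[of z y] xy show ?thesis
        by (auto simp: min_def max_def split: if_splits)
    qed
    with \<delta>(1) show ?thesis by blast
  qed
  then show ?thesis
    by (simp add: has_unif_deriv_def ivl_def pos_part_def Bex_def)
qed

theorem theorem1:
  fixes F :: "real set"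
  assumes "real_subfield F"
  shows "order_complete F \<longleftrightarrow>
    (\<forall>a\<in>F. \<forall>b\<in>F. a < b \<longrightarrow>
      (\<forall>f. f \<in> ivl F a b \<rightarrow> F \<and> continuous_ivl F a b f \<longrightarrow>
        (\<exists>G. G \<in> ivl F a b \<rightarrow> F \<and> unif_differentiable F a b G \<and>
             (\<forall>x\<in>ivl F a b. unif_deriv F a b G x = f x))))"
    (is "_ \<longleftrightarrow> ?antiderivatives")
proof
  assume "order_complete F"
  then have F: "F = UNIV"
    using assms by (rule order_complete_real_subfield[rotated])
  show ?antiderivatives
  proof (intro ballI allI impI)
    fix a b f
    assume ab: "a \<in> F" "b \<in> F" "a < b" and f: "f \<in> ivl F a b \<rightarrow> F \<and> continuous_ivl F a b f"
    have cont: "continuous_on {a..b} f"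
      using f by (simp add: F continuous_ivl_UNIV)
    then obtain G where "\<And>x. x \<in> {a..b} \<Longrightarrow> (G has_real_derivative f x) (at x within {a..b})"
      using antiderivative_continuous[of a b f]
      by (metis has_real_derivative_iff_has_vector_derivative)
    then have "has_unif_deriv F a b G f"
      using has_unif_deriv_UNIV[OF cont] by (simp add: F)
    then show "\<exists>G. G \<in> ivl F a b \<rightarrow> F \<and> unif_differentiable F a b G \<and>
        (\<forall>x\<in>ivl F a b. unif_deriv F a b G x = f x)"
      using unif_deriv_eq[OF assms ab] by (auto simp: F unif_differentiable_def)
  qed
next
  assume antiderivatives: ?antiderivatives
  show "order_complete F"
  proof (rule ccontr)
    assume "\<not> order_complete F"
    then obtain a b c where abc: "a \<in> F" "b \<in> F" "c \<notin> F" "a < c" "c < b"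
      by (rule not_order_complete_gap)
    define f :: "real \<Rightarrow> real" where "f = (\<lambda>x. if x < c then 0 else 1)"
    have ab: "a < b" using abc by simp
    have "f \<in> ivl F a b \<rightarrow> F"
      using assms by (simp add: f_def real_subfield_def)
    moreover have "continuous_ivl F a b f"
      unfolding f_def by (rule continuous_ivl_step[OF assms \<open>c \<notin> F\<close>])
    ultimately obtain G g where g: "has_unif_deriv F a b G g"
      and G: "\<forall>x\<in>ivl F a b. unif_deriv F a b G x = f x"
      using antiderivatives abc ab unfolding unif_differentiable_def by blast
    \<comment> \<open>On the interval \<open>unif_deriv\<close> agrees with the witness
      \<open>g\<close> by uniqueness and with \<open>f\<close> by assumption, so the step function
      itself is a uniform derivative of \<open>G\<close>.\<close>
    have "has_unif_deriv F a b G f"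
      using g by (rule has_unif_deriv_cong) (use G unif_deriv_eq[OF assms abc(1,2) ab g] in auto)
    then show False
      using no_unif_deriv_step[OF assms \<open>a < c\<close> \<open>c < b\<close>] by (simp add: f_def)
  qed
qed

end
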